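(* Let $X$ be a median pretree and let $\{f_n:X\to\mathbb{R}\}_{n\in\mathbb{N}}$ be a (uniformly) bounded sequence of convex (equivalently, monotone) real-valued maps. Then $(f_n)$ has a pointwise converging subsequence.
   Context: A pretree is a pair $(X,R)$ with $X$ a set and $R$ a ternary relation on $X$ (write $\langle a,b,c\rangle$ for $(a,b,c)\in R$) such that: (B1) $\langle a,b,c\rangle\Rightarrow\langle c,b,a\rangle$; (B2) $\langle a,b,c\rangle\wedge\langle a,c,b\rangle\Leftrightarrow b=c$; (B3) $\langle a,b,c\rangle\Rightarrow\langle a,b,d\rangle\vee\langle d,b,c\rangle$. Put $[u,v]=\{x\in X:\langle u,x,v\rangle\}$. The pretree is a median pretree if $[a,b]\cap[a,c]\cap[b,c]\neq\emptyset$ for all $a,b,c\in X$. A subset $C\subseteq X$ is convex if $[u,v]\subseteq C$ for all $u,v\in C$. A function $f:X\to\mathbb{R}$ is convex if the preimage of every convex subset of $\mathbb{R}$ is convex in $X$; it is monotone if $\langle u,w,v\rangle$ implies that $f(w)$ lies in the closed interval with endpoints $f(u),f(v)$. On median pretrees these two notions coincide. No continuity is assumed. *)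

theory Defs
  imports "HOL-Analysis.Analysis"
begin

locale pretree =
  fixes X :: "'a set" and R :: "('a \<times> 'a \<times> 'a) set"
  assumes R_on: "R \<subseteq> X \<times> X \<times> X"
    and B1: "\<lbrakk>a \<in> X; b \<in> X; c \<in> X; (a, b, c) \<in> R\<rbrakk> \<Longrightarrow> (c, b, a) \<in> R"
    and B2: "\<lbrakk>a \<in> X; b \<in> X; c \<in> X\<rbrakk> \<Longrightarrow> (a, b, c) \<in> R \<and> (a, c, b) \<in> R \<longleftrightarrow> b = c"
    and B3: "\<lbrakk>a \<in> X; b \<in> X; c \<in> X; d \<in> X; (a, b, c) \<in> R\<rbrakk> \<Longrightarrow> (a, b, d) \<in> R \<or> (d, b, c) \<in> R"

definition pretree_interval :: "'a set \<Rightarrow> ('a \<times> 'a \<times> 'a) set \<Rightarrow> 'a \<Rightarrow> 'a \<Rightarrow> 'a set" where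
  "pretree_interval X R u v = {x \<in> X. (u, x, v) \<in> R}"

locale median_pretree = pretree +
  assumes median: "\<lbrakk>a \<in> X; b \<in> X; c \<in> X\<rbrakk> \<Longrightarrow>
    pretree_interval X R a b \<inter> pretree_interval X R a c \<inter> pretree_interval X R b c \<noteq> {}"

definition pretree_convex :: "'a set \<Rightarrow> ('a \<times> 'a \<times> 'a) set \<Rightarrow> 'a set \<Rightarrow> bool" where
  "pretree_convex X R C \<longleftrightarrow> C \<subseteq> X \<and> (\<forall>u\<in>C. \<forall>v\<in>C. pretree_interval X R u v \<subseteq> C)"

(* A map X -> real is a total function of which only the values on X matter. *)
definition pretree_convex_fun ::
    "'a set \<Rightarrow> ('a \<times> 'a \<times> 'a) set \<Rightarrow> ('a \<Rightarrow> real) \<Rightarrow> bool" where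
  "pretree_convex_fun X R f \<longleftrightarrow> (\<forall>C. convex C \<longrightarrow> pretree_convex X R (f -` C \<inter> X))"

definition pretree_monotone_fun ::
    "'a set \<Rightarrow> ('a \<times> 'a \<times> 'a) set \<Rightarrow> ('a \<Rightarrow> real) \<Rightarrow> bool" where
  "pretree_monotone_fun X R f \<longleftrightarrow>
    (\<forall>u\<in>X. \<forall>w\<in>X. \<forall>v\<in>X. (u, w, v) \<in> R \<longrightarrow> f w \<in> closed_segment (f u) (f v))"

lemma pretree_convex_fun_iff_monotone:
  "pretree_convex_fun X R f \<longleftrightarrow> pretree_monotone_fun X R f"
proof
  assume f: "pretree_convex_fun X R f"
  show "pretree_monotone_fun X R f"
    unfolding pretree_monotone_fun_def
  proof (intro ballI impI)
    fix u w v assume *: "u \<in> X" "w \<in> X" "v \<in> X" "(u, w, v) \<in> R"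
    have "pretree_convex X R (f -` closed_segment (f u) (f v) \<inter> X)"
      using f by (simp add: pretree_convex_fun_def)
    then have "pretree_interval X R u v \<subseteq> f -` closed_segment (f u) (f v) \<inter> X"
      using * by (simp add: pretree_convex_def)
    then show "f w \<in> closed_segment (f u) (f v)"
      using * by (auto simp: pretree_interval_def)
  qed
next
  assume f: "pretree_monotone_fun X R f"
  show "pretree_convex_fun X R f"
    unfolding pretree_convex_fun_def pretree_convex_def
  proof (intro allI impI conjI ballI subsetI)
    fix C u v w
    assume C: "convex C" and u: "u \<in> f -` C \<inter> X" and v: "v \<in> f -` C \<inter> X"
      and w: "w \<in> pretree_interval X R u v"
    have "f w \<in> closed_segment (f u) (f v)"
      using f u v w by (simp add: pretree_monotone_fun_def pretree_interval_def)
    moreover have "closed_segment (f u) (f v) \<subseteq> C"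
      using u v C by (intro closed_segment_subset) simp_all
    ultimately show "w \<in> f -` C \<inter> X"
      using w by (auto simp: pretree_interval_def)
  qed simp
qed

end

theory Submission
  imports Defs "HOL-Library.Ramsey" "HOL-Library.Diagonal_Subsequence"
begin

text \<open>
  Disjoint segments pair four points of a median pretree in at most one way. Hence, for two convex
  functions and reals \<open>a < b\<close>, the sublevel and superlevel sets at \<open>a\<close> and \<open>b\<close> cannot meet in all
  four combinations. By Ramsey's theorem some subsequence has the same combination missing for all
  pairs of indices, and then no point oscillates across \<open>[a, b]\<close> infinitely often. Diagonalising
  over the rational pairs gives pointwise convergence.
\<close>

context median_pretree
begin

text \<open>The median \<open>m\<close> of \<open>p\<close>, \<open>q\<close>, \<open>r\<close> is
  on all three segments between them. B3, applied to \<open>(q, m, r)\<close> and the fourth point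
  \<open>s\<close>, puts it on the segment from \<open>q\<close> to \<open>s\<close> or on the one
  from \<open>r\<close> to \<open>s\<close>; either way it is a common point.\<close>

lemma interval_pairings_meet:
  assumes "p \<in> X" "q \<in> X" "r \<in> X" "s \<in> X"
  shows "pretree_interval X R p q \<inter> pretree_interval X R r s \<noteq> {} \<or>
         pretree_interval X R p r \<inter> pretree_interval X R q s \<noteq> {}"
proof -
  obtain m where m: "m \<in> X" "(p, m, q) \<in> R" "(p, m, r) \<in> R" "(q, m, r) \<in> R"
    using median[OF assms(1-3)] by (auto simp: pretree_interval_def)
  from B3[OF assms(2) m(1) assms(3,4) m(4)] show ?thesis
  proof
    assume "(q, m, s) \<in> R"
    then show ?thesis using m by (auto simp: pretree_interval_def)
  next
    assume "(s, m, r) \<in> R"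
    then have "(r, m, s) \<in> R" using B1 assms m by blast
    then show ?thesis using m by (auto simp: pretree_interval_def)
  qed
qed

text \<open>Points chosen in the four intersections are the corners of a square whose opposite sides
  lie in \<open>A\<close>, \<open>B\<close> and in \<open>C\<close>, \<open>D\<close>. One pair of
  opposite sides meets by \<open>interval_pairings_meet\<close>, against disjointness.\<close>

lemma disjoint_convex_pairs_not_independent:
  assumes "pretree_convex X R A" "pretree_convex X R B" "A \<inter> B = {}"
    and "pretree_convex X R C" "pretree_convex X R D" "C \<inter> D = {}"
  shows "A \<inter> C = {} \<or> A \<inter> D = {} \<or> B \<inter> C = {} \<or> B \<inter> D = {}"
proof (rule ccontr)
  assume "\<not> ?thesis"
  then obtain p q r s where pqrs: "p \<in> A \<inter> C" "q \<in> A \<inter> D" "r \<in> B \<inter> C" "s \<in> B \<inter> D"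
    by blast
  then have "p \<in> X" "q \<in> X" "r \<in> X" "s \<in> X"
    using assms by (auto simp: pretree_convex_def)
  moreover have "pretree_interval X R p q \<subseteq> A" "pretree_interval X R r s \<subseteq> B"
    "pretree_interval X R p r \<subseteq> C" "pretree_interval X R q s \<subseteq> D"
    using assms pqrs by (simp_all add: pretree_convex_def)
  ultimately show False
    using interval_pairings_meet[of p q r s] assms(3,6) by blast
qed

end

text \<open>Colour each pair of indices by an intersection that is empty. Along a homogeneous
  subsequence, a single visit of \<open>x\<close> to one fixed family bars it from another fixed
  family (possibly the same) at all later indices.\<close>

lemma ramsey_non_independent_subseq:
  fixes A B :: "nat \<Rightarrow> 'a set"
  assumes "\<And>m n. m < n \<Longrightarrow>
    A m \<inter> A n = {} \<or> A m \<inter> B n = {} \<or> B m \<inter> A n = {} \<or> B m \<inter> B n = {}"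
  shows "\<exists>r. strict_mono (r :: nat \<Rightarrow> nat) \<and>
    (\<forall>x. (\<forall>\<^sub>F k in sequentially. x \<notin> A (r k)) \<or> (\<forall>\<^sub>F k in sequentially. x \<notin> B (r k)))"
proof -
  define Q where "Q t m n \<longleftrightarrow> (if t = 0 then A m \<inter> A n = {} else if t = 1 then A m \<inter> B n = {}
    else if t = 2 then B m \<inter> A n = {} else B m \<inter> B n = {})" for t m n :: nat
  have ex: "\<exists>t<4. Q t m n" if "m < n" for m n
    using assms[OF that] by (auto simp: Q_def numeral_eq_Suc Ex_less_Suc2)
  \<comment> \<open>Ramsey's theorem colours unordered pairs, but colours 1 and 2 depend on the
    order of the indices; \<open>Min\<close> and \<open>Max\<close> recover it.\<close>
  define c where "c e = (SOME t. t < 4 \<and> Q t (Min e) (Max e))" for e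
  have c: "c {m, n} < 4 \<and> Q (c {m, n}) m n" if "m < n" for m n
  proof -
    have "Min {m, n} = m" "Max {m, n} = n"
      using that by simp_all
    then show ?thesis
      unfolding c_def by (simp only:) (rule someI_ex[OF ex[OF that]])
  qed
  have "c {m, n} < 4" if "m \<noteq> n" for m n
    using that c[of m n] c[of n m] by (cases m n rule: linorder_cases) (simp_all add: insert_commute)
  then have "\<forall>m\<in>UNIV. \<forall>n\<in>UNIV. m \<noteq> n \<longrightarrow> c {m, n} < 4"
    by simp
  from Ramsey2[OF infinite_UNIV_nat this] obtain Y t where
    Y: "infinite Y" "\<forall>m\<in>Y. \<forall>n\<in>Y. m \<noteq> n \<longrightarrow> c {m, n} = t"
    by (elim exE conjE) (rule that)
  define r where "r = enumerate Y"
  have r: "strict_mono r"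
    using Y(1) by (simp add: r_def strict_mono_def enumerate_mono)
  have Qr: "Q t (r m) (r n)" if "m < n" for m n
  proof -
    have "r m \<in> Y" "r n \<in> Y"
      using enumerate_in_set[OF Y(1)] by (simp_all add: r_def)
    then have "c {r m, r n} = t"
      using Y(2) strict_monoD[OF r that] by simp
    then show ?thesis
      using c[OF strict_monoD[OF r that]] by simp
  qed
  have evI: "\<forall>\<^sub>F k in sequentially. x \<notin> C (r k)"
    if "\<And>n. m < n \<Longrightarrow> x \<notin> C (r n)" for x m and C :: "nat \<Rightarrow> 'a set"
    by (rule eventually_mono[OF eventually_gt_at_top[of m]]) (rule that)
  have "(\<forall>\<^sub>F k in sequentially. x \<notin> A (r k)) \<or> (\<forall>\<^sub>F k in sequentially. x \<notin> B (r k))" for x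
  proof (cases "\<exists>m. x \<in> A (r m)")
    case False
    then show ?thesis by simp
  next
    case A: True
    show ?thesis
    proof (cases "\<exists>m. x \<in> B (r m)")
      case False
      then show ?thesis by simp
    next
      case True
      with A obtain i j where ij: "x \<in> A (r i)" "x \<in> B (r j)" by blast
      \<comment> \<open>The earlier index of an empty intersection belongs to an \<open>A\<close>
        for colours 0 and 1, so the visit at \<open>i\<close> is used, and to a \<open>B\<close> for
        the others, so the visit at \<open>j\<close> is used.\<close>
      consider "t = 0" | "t = 1" | "t = 2" | "t > 2" by linarith
      then show ?thesis
      proof cases
        case 1
        then show ?thesis using Qr[of i] ij by (intro disjI1 evI[of i]) (auto simp: Q_def)
      next
        case 2
        then show ?thesis using Qr[of i] ij by (intro disjI2 evI[of i]) (auto simp: Q_def)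
      next
        case 3
        then show ?thesis using Qr[of j] ij by (intro disjI1 evI[of j]) (auto simp: Q_def)
      next
        case 4
        then show ?thesis using Qr[of j] ij by (intro disjI2 evI[of j]) (auto simp: Q_def)
      qed
    qed
  qed
  with r show ?thesis by blast
qed

text \<open>The limit \<open>l\<close> of some convergent subsequence is the only candidate. Since
  \<open>u\<close> comes near \<open>l\<close> infinitely often, it cannot eventually stay beyond a
  level on either side of \<open>l\<close>, which decides the alternative in
  \<open>no_osc\<close>.\<close>

lemma convergent_if_no_rational_oscillation:
  fixes u :: "nat \<Rightarrow> real"
  assumes bounded: "Bseq u"
    and no_osc: "\<And>a b :: rat. a < b \<Longrightarrow> (\<forall>\<^sub>F n in sequentially. u n > of_rat a) \<or>
      (\<forall>\<^sub>F n in sequentially. u n < of_rat b)"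
  shows "convergent u"
proof -
  have bd: "bounded (range u)"
    using bounded by (simp add: Bseq_eq_bounded)
  then obtain l s where s: "strict_mono s" "(u \<circ> s) \<longlonglongrightarrow> l"
    using bounded_imp_convergent_subsequence by blast
  have freq: "\<not> (\<forall>\<^sub>F n in sequentially. u n > y)" if "l < y" for y
  proof
    assume "\<forall>\<^sub>F n in sequentially. u n > y"
    then have "\<forall>\<^sub>F n in sequentially. (u \<circ> s) n > y"
      using eventually_subseq[OF s(1)] by simp
    then have "y \<le> l"
      by (intro tendsto_lowerbound[OF s(2)]) (auto elim: eventually_mono)
    with that show False by simp
  qed
  have freq': "\<not> (\<forall>\<^sub>F n in sequentially. u n < y)" if "y < l" for y
  proof
    assume "\<forall>\<^sub>F n in sequentially. u n < y"
    then have "\<forall>\<^sub>F n in sequentially. (u \<circ> s) n < y"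
      using eventually_subseq[OF s(1)] by simp
    then have "l \<le> y"
      by (intro tendsto_upperbound[OF s(2)]) (auto elim: eventually_mono)
    with that show False by simp
  qed
  have "u \<longlonglongrightarrow> l"
  proof (rule order_tendstoI)
    fix y assume "y < l"
    \<comment> \<open>With rationals \<open>y < a < b < l\<close>, being eventually below
      \<open>b\<close> is excluded by \<open>freq'\<close>, so \<open>u\<close> is eventually above
      \<open>a\<close>.\<close>
    then obtain b where b: "y < of_rat b" "of_rat b < l" using of_rat_dense by blast
    from b(1) obtain a where a: "y < of_rat a" "of_rat a < (of_rat b :: real)"
      using of_rat_dense by blast
    have "\<forall>\<^sub>F n in sequentially. u n > of_rat a"
      using no_osc[of a b] freq'[OF b(2)] a by (simp add: of_rat_less)
    then show "\<forall>\<^sub>F n in sequentially. y < u n"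
      by (rule eventually_mono) (use a in simp)
  next
    fix y assume "l < y"
    then obtain a where a: "l < of_rat a" "of_rat a < y" using of_rat_dense by blast
    from a(2) obtain b where b: "of_rat a < (of_rat b :: real)" "of_rat b < y"
      using of_rat_dense by blast
    have "\<forall>\<^sub>F n in sequentially. u n < of_rat b"
      using no_osc[of a b] freq[OF a(1)] b by (simp add: of_rat_less)
    then show "\<forall>\<^sub>F n in sequentially. u n < y"
      by (rule eventually_mono) (use b in simp)
  qed
  then show ?thesis by (rule convergentI)
qed

lemma (in median_pretree) convex_fun_subseq_no_oscillation:
  fixes f :: "nat \<Rightarrow> 'a \<Rightarrow> real"
  assumes "\<And>n. pretree_convex_fun X R (f n)" and "a < b"
  shows "\<exists>r. strict_mono (r :: nat \<Rightarrow> nat) \<and>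
    (\<forall>x\<in>X. (\<forall>\<^sub>F k in sequentially. f (r k) x > a) \<or> (\<forall>\<^sub>F k in sequentially. f (r k) x < b))"
proof -
  \<comment> \<open>The level sets are closed rays, so that avoiding them gives the strict
    inequalities; they are disjoint because \<open>a < b\<close>.\<close>
  define A where "A n = f n -` {..a} \<inter> X" for n
  define B where "B n = f n -` {b..} \<inter> X" for n
  have AB: "pretree_convex X R (A n)" "pretree_convex X R (B n)" "A n \<inter> B n = {}" for n
    using assms by (auto simp: A_def B_def pretree_convex_fun_def)
  have "\<exists>r. strict_mono (r :: nat \<Rightarrow> nat) \<and>
    (\<forall>x. (\<forall>\<^sub>F k in sequentially. x \<notin> A (r k)) \<or> (\<forall>\<^sub>F k in sequentially. x \<notin> B (r k)))"
    by (rule ramsey_non_independent_subseq) (rule disjoint_convex_pairs_not_independent[OF AB AB])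
  then obtain r where r: "strict_mono r" "\<And>x. (\<forall>\<^sub>F k in sequentially. x \<notin> A (r k)) \<or>
      (\<forall>\<^sub>F k in sequentially. x \<notin> B (r k))" by blast
  have "(\<forall>\<^sub>F k in sequentially. f (r k) x > a) \<or> (\<forall>\<^sub>F k in sequentially. f (r k) x < b)"
    if "x \<in> X" for x
    using r(2)[of x] that by (simp add: A_def B_def not_le)
  with r(1) show ?thesis by blast
qed

theorem theorem4p9:
  fixes X :: "'a set" and R :: "('a \<times> 'a \<times> 'a) set" and f :: "nat \<Rightarrow> 'a \<Rightarrow> real"
  assumes "median_pretree X R"
    and "\<And>n. pretree_convex_fun X R (f n)"
    and "\<exists>M. \<forall>n. \<forall>x\<in>X. \<bar>f n x\<bar> \<le> M"
  shows "\<exists>r g. strict_mono (r :: nat \<Rightarrow> nat) \<and>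
           (\<forall>x\<in>X. (\<lambda>k. f (r k) x) \<longlonglongrightarrow> g x)"
proof -
  interpret median_pretree X R by fact
  define S :: "rat \<Rightarrow> rat \<Rightarrow> (nat \<Rightarrow> nat) \<Rightarrow> bool" where
    "S a b s \<longleftrightarrow> (a < b \<longrightarrow> (\<forall>x\<in>X. (\<forall>\<^sub>F k in sequentially. f (s k) x > of_rat a) \<or>
       (\<forall>\<^sub>F k in sequentially. f (s k) x < of_rat b)))" for a b s
  \<comment> \<open>Enumerating the rational pairs turns the requirements into a sequence, as the
    diagonal construction demands.\<close>
  define P where "P n = case_prod S (from_nat n :: rat \<times> rat)" for n :: nat
  interpret subseqs P
  proof
    fix n and s :: "nat \<Rightarrow> nat"
    obtain a b where ab: "from_nat n = (a :: rat, b :: rat)" by fastforce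
    show "\<exists>r'. strict_mono r' \<and> P n (s \<circ> r')"
    proof (cases "a < b")
      case True
      then show ?thesis
        using convex_fun_subseq_no_oscillation[of "\<lambda>k. f (s k)" "of_rat a" "of_rat b"] assms(2)
        by (simp add: P_def S_def ab of_rat_less)
    next
      case False
      then show ?thesis
        by (auto simp: P_def S_def ab intro: strict_mono_id)
    qed
  qed
  \<comment> \<open>Eventual statements survive passing to a subsequence, so later refinements keep
    what earlier ones achieved.\<close>
  have stable: "P n (s \<circ> r)" if "strict_mono r" "P n s" for r s n
  proof -
    obtain a b where ab: "from_nat n = (a :: rat, b :: rat)" by fastforce
    show ?thesis
      using that(2) eventually_subseq[OF that(1), of "\<lambda>k. f (s k) x > of_rat a" for x]
        eventually_subseq[OF that(1), of "\<lambda>k. f (s k) x < of_rat b" for x]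
      by (simp add: P_def S_def ab) blast
  qed
  have "convergent (\<lambda>k. f (diagseq k) x)" if x: "x \<in> X" for x
  proof (rule convergent_if_no_rational_oscillation)
    show "Bseq (\<lambda>k. f (diagseq k) x)"
    proof -
      obtain M where "\<forall>n. \<forall>x\<in>X. \<bar>f n x\<bar> \<le> M" using assms(3) by blast
      then show ?thesis using x by (intro BseqI'[of _ M]) simp
    qed
    fix a b :: rat assume "a < b"
    moreover define n where "n = to_nat (a, b)"
    \<comment> \<open>Only from index \<open>Suc n\<close> on is the diagonal guaranteed to run
      inside the stage that secures \<open>P n\<close>; the finitely many terms before do not affect
      eventual statements.\<close>
    have "P n (diagseq \<circ> (+) (Suc n))"
      using stable by (rule diagseq_holds)
    ultimately show "(\<forall>\<^sub>F k in sequentially. f (diagseq k) x > of_rat a) \<or>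
        (\<forall>\<^sub>F k in sequentially. f (diagseq k) x < of_rat b)"
      using x eventually_sequentially_seg[of "\<lambda>k. f (diagseq k) x > of_rat a" "Suc n"]
        eventually_sequentially_seg[of "\<lambda>k. f (diagseq k) x < of_rat b" "Suc n"]
      by (simp add: P_def S_def n_def add.commute) blast
  qed
  then have "\<forall>x\<in>X. (\<lambda>k. f (diagseq k) x) \<longlonglongrightarrow> lim (\<lambda>k. f (diagseq k) x)"
    by (simp add: convergent_LIMSEQ_iff)
  with subseq_diagseq show ?thesis by (intro exI conjI)
qed

end
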